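(* Let $w$ be a positive integer, let $p_1(y),\ldots,p_w(y)\in\mathbb{R}[y]$ be polynomials, and let $\mathbb{N}=S_1\cup S_2\cup\cdots\cup S_w$ be a partition of $\mathbb{N}$ such that each indicator function $1_{S_v}(n)$ ($v=1,\ldots,w$) is deterministic. Define \[g(n)=\sum_{v=1}^{w}1_{S_v}(n)\,p_v(n).\] Then for any real-valued arithmetic function $f(n)$ satisfying \[\lim_{n\to\infty}\|\triangle^k f(n)-g(n)\|=0\] for some $k\in\mathbb{N}$, both $e(f(n))$ and $e(\sigma(f)(n))$ are deterministic.
   Context: $\mathbb{N}=\{0,1,2,\ldots\}$; an arithmetic function is a map $\mathbb{N}\to\mathbb{C}$. An arithmetic function $\xi$ is deterministic if there exist a compact Hausdorff space $\mathcal{X}$, a continuous map $T:\mathcal{X}\to\mathcal{X}$ of zero topological entropy, a point $x_0\in\mathcal{X}$ and a continuous $F:\mathcal{X}\to\mathbb{C}$ with $\xi(n)=F(T^n x_0)$ for all $n$. $e(x)=\exp(2\pi i x)$. $\|x\|$ denotes the distance from the real number $x$ to the nearest integer. $\triangle$ is the difference operator $(\triangle f)(n)=f(n+1)-f(n)$, and $\triangle^k$ is its $k$-fold composition ($\triangle^0$ the identity). $\sigma(f)(n)=\sum_{0\le j<n}f(j)$. $1_S$ denotes the indicator function of $S\subseteq\mathbb{N}$. *)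

theory Defs
  imports "HOL-Analysis.Analysis"
begin

section \<open>Topological entropy\<close>

definition open_cover_of :: "'a topology \<Rightarrow> 'a set set \<Rightarrow> bool" where
  "open_cover_of X \<U> \<longleftrightarrow> (\<forall>U\<in>\<U>. openin X U) \<and> \<Union>\<U> = topspace X"

text \<open>The minimal cardinality of a subcover. In a compact space every open cover has a finite
  subcover, so the infimum ranges over a nonempty set of natural numbers.\<close>

definition cover_number :: "'a topology \<Rightarrow> 'a set set \<Rightarrow> nat" where
  "cover_number X \<U> = Inf (card ` {\<V>. \<V> \<subseteq> \<U> \<and> finite \<V> \<and> \<Union>\<V> = topspace X})"

text \<open>The join of \<open>\<U>, T\<inverse> \<U>, \<dots>, T\<^sup>-\<^sup>(\<^sup>n\<^sup>-\<^sup>1\<^sup>) \<U>\<close>, with preimages taken inside the space.\<close>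

definition iterated_join :: "'a topology \<Rightarrow> ('a \<Rightarrow> 'a) \<Rightarrow> 'a set set \<Rightarrow> nat \<Rightarrow> 'a set set" where
  "iterated_join X T \<U> n =
     {{x \<in> topspace X. \<forall>i<n. (T ^^ i) x \<in> A i} | A. \<forall>i<n. A i \<in> \<U>}"

text \<open>The definition of Adler, Konheim and McAndrew. The limit in the entropy of a cover exists by
  subadditivity, so it is written as a limes superior. The term for \<open>n = 0\<close> is irrelevant.\<close>

definition cover_entropy :: "'a topology \<Rightarrow> ('a \<Rightarrow> 'a) \<Rightarrow> 'a set set \<Rightarrow> ereal" where
  "cover_entropy X T \<U> =
     limsup (\<lambda>n. ereal (ln (real (cover_number X (iterated_join X T \<U> n))) / real n))"

definition topological_entropy :: "'a topology \<Rightarrow> ('a \<Rightarrow> 'a) \<Rightarrow> ereal" where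
  "topological_entropy X T = (SUP \<U>\<in>{\<U>. open_cover_of X \<U>}. cover_entropy X T \<U>)"


section \<open>Arithmetic functions\<close>

text \<open>HOL cannot quantify over types inside a formula, so the type whose subsets carry the compact
  Hausdorff space is a parameter. As a hypothesis, \<open>deterministic TYPE('a) \<xi>\<close> with a free type
  variable allows arbitrary spaces; as a conclusion, it is to be stated for a concrete type.
  The type \<open>nat \<Rightarrow> complex\<close> loses no generality: the orbit closure of \<open>\<xi>\<close> under the shift is a
  factor of the orbit closure of the point \<open>x\<^sub>0\<close> below, hence has zero entropy as well.\<close>

definition deterministic :: "'a itself \<Rightarrow> (nat \<Rightarrow> complex) \<Rightarrow> bool" where
  "deterministic (_ :: 'a itself) \<xi> \<longleftrightarrow>
     (\<exists>(X :: 'a topology) T x\<^sub>0 F.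
        compact_space X \<and> Hausdorff_space X \<and>
        continuous_map X X T \<and> topological_entropy X T = 0 \<and>
        x\<^sub>0 \<in> topspace X \<and> continuous_map X euclidean F \<and>
        (\<forall>n. \<xi> n = F ((T ^^ n) x\<^sub>0)))"

definition unit_exp :: "real \<Rightarrow> complex" where
  "unit_exp x = exp (2 * complex_of_real pi * \<i> * complex_of_real x)"

definition dist_nearest_int :: "real \<Rightarrow> real" where
  "dist_nearest_int x = infdist x \<int>"

definition difference_op :: "(nat \<Rightarrow> real) \<Rightarrow> nat \<Rightarrow> real" where
  "difference_op f n = f (n + 1) - f n"

definition summation_op :: "(nat \<Rightarrow> real) \<Rightarrow> nat \<Rightarrow> real" where
  "summation_op f n = (\<Sum>j<n. f j)"

end

theory Submission
  imports Defs "HOL-Real_Asymp.Real_Asymp"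
begin

text \<open>
  A bounded sequence is deterministic as soon as, at every precision, the number of its windows of a
  single suitable length \<open>h\<close> that start beyond some point is at most \<open>exp (\<eta> h)\<close>: longer windows are
  concatenations, so the orbit closure under the shift has entropy at most \<open>\<eta>\<close>. Conversely,
  deterministic indicators have subexponentially many windows. Modulo 1 and at precision \<open>h\<^sup>-\<^sup>D\<close> for
  every \<open>D\<close>, subexponential growth of the number of windows passes from \<open>\<triangle>f\<close> to \<open>f\<close>: a window of \<open>f\<close> is
  given by its first value and the window of \<open>\<triangle>f\<close>, so the count grows only by a power of \<open>h\<close> and
  the precision drops by a power of \<open>h\<close>. This yields polynomials, then \<open>g\<close>, then \<open>f\<close> and
  \<open>\<sigma>(f)\<close>, since \<open>\<triangle>\<^sup>k\<^sup>+\<^sup>1 \<sigma>(f) = \<triangle>\<^sup>k f\<close>.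
\<close>

section \<open>Distance to the nearest integer\<close>

lemma dist_nearest_int_le: "dist_nearest_int x \<le> \<bar>x - of_int n\<bar>"
  unfolding dist_nearest_int_def using infdist_le[of "of_int n" \<int> x]
  by (simp add: dist_real_def)

text \<open>The integers form a nonempty closed set, so the infimum is a minimum. Subadditivity and
  symmetry then follow by adding or negating the nearest integers.\<close>

lemma dist_nearest_int_attained:
  obtains n where "dist_nearest_int x = \<bar>x - of_int n\<bar>"
proof -
  obtain y where "y \<in> \<int>" "infdist x \<int> = dist x y"
    using infdist_attains_inf[of "\<int> :: real set" x] Ints_0 closed_Ints by blast
  then show ?thesis
    using that by (auto simp: dist_nearest_int_def dist_real_def elim!: Ints_cases)
qed

lemma dist_nearest_int_nonneg [simp]: "dist_nearest_int x \<ge> 0"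
  by (simp add: dist_nearest_int_def infdist_nonneg)

lemma dist_nearest_int_le_abs: "dist_nearest_int x \<le> \<bar>x\<bar>"
  using dist_nearest_int_le[of x 0] by simp

lemma dist_nearest_int_0 [simp]: "dist_nearest_int 0 = 0"
  using dist_nearest_int_le_abs[of 0] dist_nearest_int_nonneg[of 0] by simp

lemma dist_nearest_int_minus: "dist_nearest_int (- x) = dist_nearest_int x"
proof -
  have "dist_nearest_int (- y) \<le> dist_nearest_int y" for y
  proof -
    obtain n where "dist_nearest_int y = \<bar>y - of_int n\<bar>"
      by (rule dist_nearest_int_attained)
    then show ?thesis
      using dist_nearest_int_le[of "- y" "- n"] by simp
  qed
  from this[of x] this[of "- x"] show ?thesis
    by simp
qed

lemma dist_nearest_int_add_le:
  "dist_nearest_int (x + y) \<le> dist_nearest_int x + dist_nearest_int y"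
proof -
  obtain m where m: "dist_nearest_int x = \<bar>x - of_int m\<bar>"
    by (rule dist_nearest_int_attained)
  obtain n where n: "dist_nearest_int y = \<bar>y - of_int n\<bar>"
    by (rule dist_nearest_int_attained)
  show ?thesis
    using m n dist_nearest_int_le[of "x + y" "m + n"] by simp
qed

lemma dist_nearest_int_sum_le:
  "dist_nearest_int (\<Sum>i\<in>I. a i) \<le> (\<Sum>i\<in>I. dist_nearest_int (a i))"
proof (induction I rule: infinite_finite_induct)
  case (insert i I)
  then show ?case
    using dist_nearest_int_add_le[of "a i" "\<Sum>i\<in>I. a i"] by simp
qed simp_all

section \<open>The exponential as a Lipschitz map on the reals modulo 1\<close>

lemma unit_exp_eq_cis: "unit_exp x = cis (2 * pi * x)"
  by (simp add: unit_exp_def cis_conv_exp mult_ac)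

text \<open>The chord has length 2 |sin((a - b) / 2)|, which is at most the length of the
  arc.\<close>

lemma norm_cis_diff_le: "norm (cis a - cis b) \<le> \<bar>a - b\<bar>"
proof -
  have "(norm (cis a - cis b))\<^sup>2 = (cos a - cos b)\<^sup>2 + (sin a - sin b)\<^sup>2"
    by (simp add: cmod_power2)
  also have "\<dots> = 2 - 2 * cos (a - b)"
    using sin_cos_squared_add[of a] sin_cos_squared_add[of b]
    by (simp add: cos_diff power2_eq_square algebra_simps)
  also have "\<dots> = (2 * sin ((a - b) / 2))\<^sup>2"
  proof -
    have "cos (2 * t) = 1 - 2 * (sin t)\<^sup>2" for t :: real
      by (rule cos_double_sin)
    from this[of "(a - b) / 2"] have "cos (a - b) = 1 - 2 * (sin ((a - b) / 2))\<^sup>2"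
      by (simp only: mult_2 field_sum_of_halves)
    then show ?thesis
      by (simp add: power_mult_distrib)
  qed
  finally have "norm (cis a - cis b) = \<bar>2 * sin ((a - b) / 2)\<bar>"
    by (rule power2_eq_imp_eq[OF trans[OF _ power2_abs[symmetric]]]) simp_all
  also have "\<dots> \<le> \<bar>a - b\<bar>"
    using abs_sin_x_le_abs_x[of "(a - b) / 2"] by simp
  finally show ?thesis .
qed

lemma dist_unit_exp_le: "dist (unit_exp x) (unit_exp y) \<le> 2 * pi * dist_nearest_int (x - y)"
proof -
  obtain n where n: "dist_nearest_int (x - y) = \<bar>x - y - of_int n\<bar>"
    by (rule dist_nearest_int_attained)
  have "unit_exp x = unit_exp (x - of_int n)"
    by (simp add: unit_exp_eq_cis right_diff_distrib cis_divide[symmetric])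
  then have "dist (unit_exp x) (unit_exp y) \<le> \<bar>2 * pi * (x - of_int n) - 2 * pi * y\<bar>"
    using norm_cis_diff_le by (simp add: unit_exp_eq_cis dist_norm)
  also have "2 * pi * (x - of_int n) - 2 * pi * y = 2 * pi * (x - y - of_int n)"
    by (simp add: algebra_simps)
  also have "\<bar>\<dots>\<bar> = 2 * pi * dist_nearest_int (x - y)"
    unfolding n by (simp add: abs_mult)
  finally show ?thesis .
qed


section \<open>Partitions into few pieces\<close>

text \<open>Closeness of windows is not transitive, so it is required only inside each colour class
  of \<open>c\<close> instead of counting equivalence classes. The bound is real so that expressions
  such as \<open>exp (\<eta> * real h)\<close> can be inserted directly.\<close>

definition coverable :: "real \<Rightarrow> nat set \<Rightarrow> (nat \<Rightarrow> nat \<Rightarrow> bool) \<Rightarrow> bool" where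
  "coverable K A E \<longleftrightarrow> (\<exists>(c :: nat \<Rightarrow> nat) N. real N \<le> K \<and> (\<forall>n\<in>A. c n < N) \<and>
     (\<forall>n\<in>A. \<forall>m\<in>A. c n = c m \<longrightarrow> E n m))"

lemma coverable_mono:
  assumes "coverable K A E" "K \<le> K'" "B \<subseteq> A"
    and "\<And>n m. n \<in> B \<Longrightarrow> m \<in> B \<Longrightarrow> E n m \<Longrightarrow> E' n m"
  shows "coverable K' B E'"
proof -
  obtain c :: "nat \<Rightarrow> nat" and N where "real N \<le> K" "\<forall>n\<in>A. c n < N"
    "\<forall>n\<in>A. \<forall>m\<in>A. c n = c m \<longrightarrow> E n m"
    using assms(1) unfolding coverable_def by blast
  then show ?thesis
    unfolding coverable_def using assms(2-4)
    by (intro exI[of _ c] exI[of _ N]) (meson order_trans subsetD)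
qed

lemma coverable_conj:
  assumes "coverable K A E" "coverable K' A E'"
  shows "coverable (K * K') A (\<lambda>n m. E n m \<and> E' n m)"
proof -
  obtain c :: "nat \<Rightarrow> nat" and N where c: "real N \<le> K" "\<forall>n\<in>A. c n < N"
    "\<forall>n\<in>A. \<forall>m\<in>A. c n = c m \<longrightarrow> E n m"
    using assms(1) unfolding coverable_def by blast
  obtain c' :: "nat \<Rightarrow> nat" and N' where c': "real N' \<le> K'" "\<forall>n\<in>A. c' n < N'"
    "\<forall>n\<in>A. \<forall>m\<in>A. c' n = c' m \<longrightarrow> E' n m"
    using assms(2) unfolding coverable_def by blast
  \<comment> \<open>A pair of colours is encoded as a two-digit number whose last digit is in base
    \<open>N'\<close>.\<close>
  define d where "d n = c n * N' + c' n" for n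
  have d: "d n div N' = c n" "d n mod N' = c' n" if "n \<in> A" for n
    using that c'(2) by (auto simp: d_def)
  have "d n < N * N'" if "n \<in> A" for n
  proof -
    have "d n < Suc (c n) * N'"
      using that c'(2) by (simp add: d_def)
    also have "\<dots> \<le> N * N'"
      using that c(2) by (intro mult_right_mono) (auto simp: Suc_le_eq)
    finally show ?thesis .
  qed
  moreover have "real (N * N') \<le> K * K'"
    unfolding of_nat_mult using c(1) c'(1) of_nat_0_le_iff order_trans
    by (intro mult_mono) blast+
  moreover have "E n m \<and> E' n m" if "n \<in> A" "m \<in> A" "d n = d m" for n m
    using d[of n] d[of m] that c(3) c'(3) by auto
  ultimately show ?thesis
    unfolding coverable_def by blast
qed

lemma coverable_Un:
  assumes "coverable K A E" "coverable K' B E"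
  shows "coverable (K + K') (A \<union> B) E"
proof -
  obtain c :: "nat \<Rightarrow> nat" and N where c: "real N \<le> K" "\<forall>n\<in>A. c n < N"
    "\<forall>n\<in>A. \<forall>m\<in>A. c n = c m \<longrightarrow> E n m"
    using assms(1) unfolding coverable_def by blast
  obtain c' :: "nat \<Rightarrow> nat" and N' where c': "real N' \<le> K'" "\<forall>n\<in>B. c' n < N'"
    "\<forall>n\<in>B. \<forall>m\<in>B. c' n = c' m \<longrightarrow> E n m"
    using assms(2) unfolding coverable_def by blast
  define d where "d n = (if n \<in> A then c n else N + c' n)" for n
  have "\<forall>n\<in>A \<union> B. d n < N + N'" "real (N + N') \<le> K + K'"
    using c c' by (auto simp: d_def)
  moreover have "E n m" if "n \<in> A \<union> B" "m \<in> A \<union> B" "d n = d m" for n m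
    using that c c' by (auto simp: d_def split: if_splits)
  ultimately show ?thesis
    unfolding coverable_def by blast
qed

lemma coverable_vimage:
  assumes "coverable K A E" "\<And>n. n \<in> B \<Longrightarrow> s n \<in> A"
  shows "coverable K B (\<lambda>n m. E (s n) (s m))"
proof -
  obtain c :: "nat \<Rightarrow> nat" and N where "real N \<le> K" "\<forall>n\<in>A. c n < N"
    "\<forall>n\<in>A. \<forall>m\<in>A. c n = c m \<longrightarrow> E n m"
    using assms(1) unfolding coverable_def by blast
  then show ?thesis
    unfolding coverable_def using assms(2)
    by (intro exI[of _ "c \<circ> s"] exI[of _ N]) auto
qed

lemma coverable_lessThan:
  assumes "\<And>n. E n n"
  shows "coverable (real n) {..<n} E"
  unfolding coverable_def using assms by (intro exI[of _ "\<lambda>i. i"] exI[of _ n]) auto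

lemma coverable_trivial:
  assumes "K \<ge> 1" "\<And>n m. E n m"
  shows "coverable K A E"
  unfolding coverable_def using assms by (intro exI[of _ "\<lambda>_. 0"] exI[of _ 1]) auto

text \<open>Colouring each \<open>n\<close> by some member of the cover that contains
  \<open>y n\<close> turns a finite subcover in a dynamical system into a partition of
  times.\<close>

lemma coverable_finite_cover:
  assumes "finite \<V>" and "\<And>n. n \<in> A \<Longrightarrow> \<exists>V\<in>\<V>. y n \<in> V"
    and "\<And>V n m. V \<in> \<V> \<Longrightarrow> y n \<in> V \<Longrightarrow> y m \<in> V \<Longrightarrow> E n m"
  shows "coverable (real (card \<V>)) A E"
proof -
  obtain b where b: "bij_betw b \<V> {0..<card \<V>}"
    using ex_bij_betw_finite_nat[OF assms(1)] ..
  define V where "V n = (SOME V. V \<in> \<V> \<and> y n \<in> V)" for n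
  have V: "V n \<in> \<V> \<and> y n \<in> V n" if "n \<in> A" for n
  proof -
    have "\<exists>V. V \<in> \<V> \<and> y n \<in> V"
      using assms(2)[OF that] by blast
    then show ?thesis
      unfolding V_def by (rule someI_ex)
  qed
  have "b (V n) < card \<V>" if "n \<in> A" for n
    using V[OF that] bij_betwE[OF b] by auto
  moreover have "E n m" if "n \<in> A" "m \<in> A" "b (V n) = b (V m)" for n m
  proof -
    have "V n = V m"
      using bij_betw_imp_inj_on[OF b] V that by (auto dest: inj_onD)
    then show ?thesis
      using V[OF that(1)] V[OF that(2)] assms(3)[of "V n" n m] by simp
  qed
  ultimately show ?thesis
    unfolding coverable_def by (intro exI[of _ "\<lambda>n. b (V n)"] exI[of _ "card \<V>"]) auto
qed

text \<open>The circle is cut into q arcs of length 1/q, and the colour of n is the index of the arc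
  containing the fractional part of \<open>x n\<close>. Writing precision as a product bounded by 1
  avoids division throughout.\<close>

lemma coverable_mod_1:
  fixes q :: nat
  assumes "q > 0"
  shows "coverable (real q) UNIV (\<lambda>n m. dist_nearest_int (x n - x m) * real q \<le> 1)"
proof -
  define c where "c n = nat \<lfloor>real q * frac (x n)\<rfloor>" for n :: nat
  have "c n < q" for n
  proof -
    have "real q * frac (x n) < real q"
      using assms frac_lt_1[of "x n"] by simp
    then show ?thesis
      unfolding c_def using assms by (simp add: nat_less_iff floor_less_iff frac_ge_0)
  qed
  moreover have "dist_nearest_int (x n - x m) * real q \<le> 1" if "c n = c m" for n m
  proof -
    have "\<lfloor>real q * frac (x n)\<rfloor> = \<lfloor>real q * frac (x m)\<rfloor>"
      using that by (auto simp: c_def nat_eq_iff2 frac_ge_0)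
    then have "\<bar>real q * frac (x n) - real q * frac (x m)\<bar> \<le> 1"
      by linarith
    then have "\<bar>frac (x n) - frac (x m)\<bar> * real q \<le> 1"
      by (simp add: abs_mult left_diff_distrib right_diff_distrib[symmetric] mult.commute)
    moreover have "dist_nearest_int (x n - x m) \<le> \<bar>frac (x n) - frac (x m)\<bar>"
      using dist_nearest_int_le[of "x n - x m" "\<lfloor>x n\<rfloor> - \<lfloor>x m\<rfloor>"] by (simp add: frac_def algebra_simps)
    ultimately show ?thesis
      by (meson mult_right_mono of_nat_0_le_iff order_trans)
  qed
  ultimately show ?thesis
    unfolding coverable_def by (intro exI[of _ c] exI[of _ q]) auto
qed


section \<open>Determinism and the number of windows\<close>

lemma coverable_long_windows:
  fixes \<xi> :: "nat \<Rightarrow> 'b :: metric_space"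
  assumes cov: "coverable K {n0..} (\<lambda>n m. \<forall>j<h. dist (\<xi> (n + j)) (\<xi> (m + j)) \<le> \<epsilon>)"
    and "K \<ge> 1" "h > 0" "\<epsilon> \<ge> 0"
  shows "coverable (real n0 + K ^ Suc (M div h)) UNIV
           (\<lambda>n m. \<forall>j<M. dist (\<xi> (n + j)) (\<xi> (m + j)) \<le> \<epsilon>)"
proof -
  define E where "E M n m \<longleftrightarrow> (\<forall>j<M. dist (\<xi> (n + j)) (\<xi> (m + j)) \<le> \<epsilon>)" for M n m
  \<comment> \<open>A window of length q h is a concatenation of q blocks of length h, all starting
    at or after \<open>n0\<close>. The colours of the blocks together colour the window, and
    \<epsilon> does not deteriorate.\<close>
  have "coverable (K ^ q) {n0..} (E (q * h))" for q
  proof (induction q)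
    case 0
    show ?case
      by (rule coverable_trivial) (auto simp: E_def)
  next
    case (Suc q)
    have "coverable K {n0..} (\<lambda>n m. E h (n + q * h) (m + q * h))"
      using coverable_vimage[OF cov, of "{n0..}" "\<lambda>n. n + q * h"] by (simp add: E_def)
    from coverable_conj[OF this Suc]
    show ?case
    proof (rule coverable_mono)
      fix n m
      assume *: "E h (n + q * h) (m + q * h) \<and> E (q * h) n m"
      show "E (Suc q * h) n m"
        unfolding E_def
      proof (intro allI impI)
        fix j assume "j < Suc q * h"
        show "dist (\<xi> (n + j)) (\<xi> (m + j)) \<le> \<epsilon>"
        proof (cases "j < q * h")
          case False
          then have "j - q * h < h"
            using \<open>j < Suc q * h\<close> by simp
          then have "dist (\<xi> (n + q * h + (j - q * h))) (\<xi> (m + q * h + (j - q * h))) \<le> \<epsilon>"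
            using * unfolding E_def by blast
          then show ?thesis
            using False by simp
        qed (use * in \<open>auto simp: E_def\<close>)
      qed
    qed auto
  qed
  \<comment> \<open>Each of the finitely many starts below \<open>n0\<close> gets a piece of its
    own.\<close>
  moreover have "coverable (real n0) {..<n0} (E (Suc (M div h) * h))"
    by (rule coverable_lessThan) (use \<open>\<epsilon> \<ge> 0\<close> in \<open>auto simp: E_def\<close>)
  ultimately have "coverable (real n0 + K ^ Suc (M div h)) ({..<n0} \<union> {n0..}) (E (Suc (M div h) * h))"
    by (intro coverable_Un)
  moreover have "M \<le> Suc (M div h) * h"
    using \<open>h > 0\<close> dividend_less_div_times[of h M] by simp
  ultimately show ?thesis
    by (elim coverable_mono) (auto simp: E_def)
qed

lemma dist_fun_less_of_first_terms:
  fixes \<delta> :: real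
  assumes "\<delta> > 0"
  shows "\<exists>L :: nat. \<exists>\<epsilon>>0. \<forall>x y :: nat \<Rightarrow> 'b :: metric_space.
    (\<forall>i<L. dist (x i) (y i) \<le> \<epsilon>) \<longrightarrow> dist x y < \<delta>"
proof -
  obtain N where N: "(1 / 2 :: real) ^ N < \<delta> / 2"
    using real_arch_pow_inv[of "\<delta> / 2" "1 / 2"] assms by auto
  \<comment> \<open>The metric on functions weights the coordinates in the order given by
    \<open>from_nat\<close>, so \<open>L\<close> has to exceed all of the first N + 1 indices in
    that order.\<close>
  define L where "L = Suc (Max ((from_nat :: nat \<Rightarrow> nat) ` {..N}))"
  have L: "(from_nat n :: nat) < L" if "n \<le> N" for n
    using that by (auto simp: L_def less_Suc_eq_le)
  show ?thesis
  proof (intro exI conjI allI impI)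
    show "\<delta> / 4 > 0"
      using assms by simp
    fix x y :: "nat \<Rightarrow> 'b"
    assume *: "\<forall>i<L. dist (x i) (y i) \<le> \<delta> / 4"
    have "dist x y \<le> 2 * Max {dist (x (from_nat n)) (y (from_nat n)) |n. n \<le> N} + (1/2)^N"
      by (rule dist_fun_le_dist_first_terms)
    also have "Max {dist (x (from_nat n)) (y (from_nat n)) |n. n \<le> N} \<le> \<delta> / 4"
      using * L by (subst Max_le_iff) auto
    finally show "dist x y < \<delta>"
      using N by simp
  qed
qed

lemma cover_entropy_nonneg: "cover_entropy X T \<U> \<ge> 0"
proof -
  have "ereal (ln (real N) / real n) \<ge> 0" for N n :: nat
    \<comment> \<open>The default values \<open>ln 0 = 0\<close> and \<open>x / 0 = 0\<close> keep
      the degenerate terms nonnegative.\<close>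
    by (cases "N = 0") (auto intro!: divide_nonneg_nonneg)
  then show ?thesis
    unfolding cover_entropy_def by (intro le_Limsup) (auto intro: always_eventually)
qed

lemma cover_number_le:
  assumes "\<V> \<subseteq> \<U>" "finite \<V>" "\<Union>\<V> = topspace X"
  shows "cover_number X \<U> \<le> card \<V>"
  unfolding cover_number_def using assms by (intro cInf_lower) auto

text \<open>The constants \<open>n0\<close> and \<open>L\<close> and the rounding up to a multiple
  of \<open>h\<close> add only a bounded amount to the logarithm, which disappears after division by
  N.\<close>

lemma cover_entropy_le:
  assumes "h > 0" "\<eta> \<ge> 0"
    and bound: "\<And>N. real (cover_number X (iterated_join X T \<U> N))
           \<le> real n0 + exp (\<eta> * real h) ^ Suc ((N + L) div h)"
  shows "cover_entropy X T \<U> \<le> ereal \<eta>"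
proof -
  define b where "b N = (ln (real n0 + 1) + \<eta> * (real N + real L + real h)) / real N" for N :: nat
  have "ereal (ln (real (cover_number X (iterated_join X T \<U> N))) / real N) \<le> ereal (b N)" for N
  proof -
    define q where "q = Suc ((N + L) div h)"
    define C where "C = cover_number X (iterated_join X T \<U> N)"
    have q: "real q * real h \<le> real N + real L + real h"
    proof -
      have "q * h \<le> N + L + h"
        unfolding q_def by (simp add: div_times_less_eq_dividend)
      then show ?thesis
        by (metis of_nat_add of_nat_le_iff of_nat_mult)
    qed
    have "real C \<le> real n0 + exp (\<eta> * real h) ^ q"
      using bound[of N] by (simp add: C_def q_def)
    \<comment> \<open>The power is at least 1, so the sum can be replaced by a product whose
      logarithm splits.\<close>
    also have "\<dots> \<le> (real n0 + 1) * exp (\<eta> * real h) ^ q"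
    proof -
      have "real n0 * 1 \<le> real n0 * exp (\<eta> * real h) ^ q"
        using \<open>\<eta> \<ge> 0\<close> by (intro mult_left_mono one_le_power) auto
      then show ?thesis
        by (simp add: distrib_right)
    qed
    finally have C: "real C \<le> (real n0 + 1) * exp (\<eta> * real h) ^ q" .
    have "ln (real C) \<le> ln (real n0 + 1) + \<eta> * (real N + real L + real h)"
    proof (cases "C = 0")
      case False
      then have "ln (real C) \<le> ln ((real n0 + 1) * exp (\<eta> * real h) ^ q)"
        using C by (subst ln_le_cancel_iff) auto
      also have "\<dots> = ln (real n0 + 1) + \<eta> * (real q * real h)"
        by (simp add: ln_mult ln_realpow mult_ac)
      also have "\<dots> \<le> ln (real n0 + 1) + \<eta> * (real N + real L + real h)"
        using q \<open>\<eta> \<ge> 0\<close> by (intro add_left_mono mult_left_mono)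
      finally show ?thesis .
    qed (use \<open>\<eta> \<ge> 0\<close> in auto)
    then show ?thesis
      by (simp add: C_def b_def divide_right_mono)
  qed
  then have "cover_entropy X T \<U> \<le> limsup (\<lambda>N. ereal (b N))"
    unfolding cover_entropy_def by (intro Limsup_mono always_eventually) auto
  also have "b \<longlonglongrightarrow> \<eta>"
    unfolding b_def by real_asymp
  then have "limsup (\<lambda>N. ereal (b N)) = ereal \<eta>"
    by (intro lim_imp_Limsup) auto
  finally show ?thesis .
qed

lemma funpow_shift: "((\<lambda>x n. x (Suc n)) ^^ i) x = (\<lambda>n. x (n + i))"
  by (induction i arbitrary: x) (auto simp: funpow_Suc_right simp del: funpow.simps)

text \<open>The system is the shift on the orbit closure of \<open>\<xi>\<close>, observed through
  the coordinate 0. A Lebesgue number of an open cover reduces membership in the cover to finitely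
  many coordinates, so a piece of the partition of long windows yields one member of the iterated
  join.\<close>

lemma deterministicI:
  fixes \<xi> :: "nat \<Rightarrow> complex"
  assumes "bounded (range \<xi>)"
    and cov: "\<And>\<epsilon> \<eta>. \<epsilon> > 0 \<Longrightarrow> \<eta> > 0 \<Longrightarrow> \<exists>h>0. \<exists>n0. coverable (exp (\<eta> * real h)) {n0..}
           (\<lambda>n m. \<forall>j<h. dist (\<xi> (n + j)) (\<xi> (m + j)) \<le> \<epsilon>)"
  shows "deterministic TYPE(nat \<Rightarrow> complex) \<xi>"
proof -
  define T :: "(nat \<Rightarrow> complex) \<Rightarrow> nat \<Rightarrow> complex" where "T = (\<lambda>x n. x (Suc n))"
  define Orb where "Orb = range (\<lambda>n j. \<xi> (n + j))"
  define X where "X = top_of_set (closure Orb)"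
  have T_pow: "(T ^^ i) x = (\<lambda>n. x (n + i))" for i x
    unfolding T_def by (rule funpow_shift)
  have cont_T: "continuous_on UNIV T"
    unfolding T_def by (intro continuous_on_coordinatewise_then_product) simp
  have "T ` Orb \<subseteq> Orb"
  proof (rule image_subsetI)
    fix x assume "x \<in> Orb"
    then obtain n where "x = (\<lambda>j. \<xi> (n + j))"
      unfolding Orb_def by blast
    then have "T x = (\<lambda>j. \<xi> (Suc n + j))"
      by (simp add: T_def)
    then show "T x \<in> Orb"
      unfolding Orb_def by (rule range_eqI)
  qed
  then have "T ` Orb \<subseteq> closure Orb"
    using closure_subset by blast
  then have T_closure: "T ` closure Orb \<subseteq> closure Orb"
    by (intro image_closure_subset continuous_on_subset[OF cont_T]) auto
  then have T_pow_closure: "(T ^^ i) x \<in> closure Orb" if "x \<in> closure Orb" for i x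
    using that by (induction i) auto
  have compact: "compact (closure Orb)"
  proof -
    obtain B where B: "\<And>n. \<xi> n \<in> cball 0 B"
      using assms(1) by (auto simp: bounded_iff)
    \<comment> \<open>Tychonoff: boundedness places the orbit in a product of closed discs.\<close>
    have "compactin (product_topology (\<lambda>_. euclidean) UNIV) (PiE UNIV (\<lambda>_ :: nat. cball (0 :: complex) B))"
      by (subst compactin_PiE) auto
    then have K: "compact (PiE UNIV (\<lambda>_ :: nat. cball (0 :: complex) B))"
      by (simp add: euclidean_product_topology)
    have "closure Orb \<subseteq> PiE UNIV (\<lambda>_ :: nat. cball (0 :: complex) B)"
      using B by (intro closure_minimal compact_imp_closed[OF K]) (auto simp: Orb_def)
    then show ?thesis
      using compact_Int_closed[OF K closed_closure[of Orb]] by (simp add: Int_absorb1)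
  qed
  have entropy: "cover_entropy X T \<U> \<le> ereal \<eta>" if \<U>: "open_cover_of X \<U>" and "\<eta> > 0" for \<U> \<eta>
  proof -
    \<comment> \<open>Members of the cover are open only relative to the orbit closure. The Lebesgue
      number lemma is applied to the open sets of the whole space that cut them out.\<close>
    define \<G> where "\<G> = {G. open G \<and> closure Orb \<inter> G \<in> \<U>}"
    have "closure Orb \<subseteq> \<Union>\<G>"
    proof
      fix x assume "x \<in> closure Orb"
      then obtain U where U: "U \<in> \<U>" "x \<in> U"
        using \<U> by (auto simp: open_cover_of_def X_def)
      then obtain G where "open G" "U = closure Orb \<inter> G"
        using \<U> by (auto simp: open_cover_of_def X_def openin_open)
      then show "x \<in> \<Union>\<G>"
        using U unfolding \<G>_def by blast
    qed
    then have "\<exists>\<delta>>0. \<forall>x\<in>closure Orb. \<exists>G\<in>\<G>. ball x \<delta> \<subseteq> G"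
    proof (rule Heine_Borel_lemma[OF compact])
      show "open G" if "G \<in> \<G>" for G
        using that by (simp add: \<G>_def)
      fix \<delta> :: real
      assume "\<delta> > 0" "\<And>x. x \<in> closure Orb \<Longrightarrow> \<exists>G\<in>\<G>. ball x \<delta> \<subseteq> G"
      then show ?thesis
        by (intro exI[of _ \<delta>] conjI ballI)
    qed
    then obtain \<delta> where "\<delta> > 0" and \<delta>: "\<forall>x\<in>closure Orb. \<exists>G\<in>\<G>. ball x \<delta> \<subseteq> G"
      by (elim exE conjE)
    obtain L \<epsilon> where "\<epsilon> > 0"
      and L: "\<forall>x y :: nat \<Rightarrow> complex. (\<forall>i<L. dist (x i) (y i) \<le> \<epsilon>) \<longrightarrow> dist x y < \<delta>"
      using dist_fun_less_of_first_terms[OF \<open>\<delta> > 0\<close>] by blast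
    obtain h n0 where "h > 0" and h: "coverable (exp (\<eta> * real h)) {n0..}
           (\<lambda>n m. \<forall>j<h. dist (\<xi> (n + j)) (\<xi> (m + j)) \<le> \<epsilon>)"
      using cov[OF \<open>\<epsilon> > 0\<close> \<open>\<eta> > 0\<close>] by blast
    \<comment> \<open>Windows of length N + L are compared, because each of the shifts by k < N has
      to be controlled on \<open>L\<close> coordinates.\<close>
    have "real (cover_number X (iterated_join X T \<U> N))
           \<le> real n0 + exp (\<eta> * real h) ^ Suc ((N + L) div h)" (is "_ \<le> ?K") for N
    proof -
      obtain c :: "nat \<Rightarrow> nat" and C where C: "real C \<le> ?K" "\<And>n. c n < C"
        "\<And>n m j. c n = c m \<Longrightarrow> j < N + L \<Longrightarrow> dist (\<xi> (n + j)) (\<xi> (m + j)) \<le> \<epsilon>"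
      proof -
        have "coverable ?K UNIV (\<lambda>n m. \<forall>j<N + L. dist (\<xi> (n + j)) (\<xi> (m + j)) \<le> \<epsilon>)"
          using \<open>h > 0\<close> \<open>\<epsilon> > 0\<close> \<open>\<eta> > 0\<close> by (intro coverable_long_windows[OF h]) auto
        then obtain c :: "nat \<Rightarrow> nat" and C where "real C \<le> ?K" "\<forall>n\<in>UNIV. c n < C"
          "\<forall>n\<in>UNIV. \<forall>m\<in>UNIV. c n = c m \<longrightarrow> (\<forall>j<N + L. dist (\<xi> (n + j)) (\<xi> (m + j)) \<le> \<epsilon>)"
          unfolding coverable_def by (elim exE conjE)
        then show ?thesis
          by (intro that[of C c]) simp_all
      qed
      \<comment> \<open>A representative start for each colour that occurs; only colours in
        \<open>range c\<close> enter the subcover below.\<close>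
      define r where "r i = (SOME n. c n = i)" for i
      have r: "c (r (c n)) = c n" for n
        unfolding r_def by (rule someI) simp
      have "\<exists>U\<in>\<U>. closure Orb \<inter> ball (\<lambda>j. \<xi> (r i + k + j)) \<delta> \<subseteq> U" for i k
      proof -
        have "(\<lambda>j. \<xi> (r i + k + j)) \<in> closure Orb"
          by (rule subsetD[OF closure_subset]) (auto simp: Orb_def)
        from bspec[OF \<delta> this] show ?thesis
          unfolding \<G>_def by blast
      qed
      then obtain U where U: "\<And>i k. U i k \<in> \<U>"
        "\<And>i k. closure Orb \<inter> ball (\<lambda>j. \<xi> (r i + k + j)) \<delta> \<subseteq> U i k"
        by metis
      \<comment> \<open>The member of the join that follows the representative \<open>r i\<close>:
        \<open>U i k\<close> contains the part of the \<delta>-ball around its k-th shift that lies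
        in the orbit closure.\<close>
      define J where "J i = {x \<in> topspace X. \<forall>k<N. (T ^^ k) x \<in> U i k}" for i
      \<comment> \<open>Limit points inherit a colour: closeness with a non-strict bound is a closed
        condition, and a finite union of closed sets containing the orbit contains its
        closure.\<close>
      have near: "\<exists>i\<in>range c. \<forall>j<N + L. dist (\<xi> (r i + j)) (x j) \<le> \<epsilon>" if "x \<in> closure Orb" for x
      proof -
        define P where "P i = (\<Inter>j<N + L. {x :: nat \<Rightarrow> complex. dist (\<xi> (r i + j)) (x j) \<le> \<epsilon>})" for i
        have "closed (P i)" for i
          unfolding P_def by (intro closed_INT ballI closed_Collect_le continuous_intros) auto
        moreover have "finite (range c)"
          using C(2) by (intro finite_subset[of "range c" "{..<C}"]) auto
        ultimately have "closed (\<Union>i\<in>range c. P i)"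
          by (intro closed_UN) auto
        moreover have "Orb \<subseteq> (\<Union>i\<in>range c. P i)"
        proof -
          have "(\<lambda>j. \<xi> (n + j)) \<in> P (c n)" for n
            using C(3)[OF r] by (auto simp: P_def)
          then show ?thesis
            by (auto simp: Orb_def)
        qed
        ultimately have "x \<in> (\<Union>i\<in>range c. P i)"
          using that closure_minimal by blast
        then show ?thesis
          by (auto simp: P_def)
      qed
      have "cover_number X (iterated_join X T \<U> N) \<le> card (J ` range c)"
      proof (rule cover_number_le)
        show "J ` range c \<subseteq> iterated_join X T \<U> N"
          using U(1) unfolding iterated_join_def J_def by blast
        show "finite (J ` range c)"
          using C(2) by (intro finite_imageI finite_subset[of "range c" "{..<C}"]) auto
        have "x \<in> \<Union> (J ` range c)" if x: "x \<in> closure Orb" for x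
        proof -
          obtain i where i: "i \<in> range c" "\<forall>j<N + L. dist (\<xi> (r i + j)) (x j) \<le> \<epsilon>"
            using near[OF x] by (elim bexE)
          have "(T ^^ k) x \<in> U i k" if "k < N" for k
          proof -
            have "dist (\<lambda>j. \<xi> (r i + k + j)) ((T ^^ k) x) < \<delta>"
            proof (rule L[rule_format])
              fix j assume "j < L"
              then show "dist (\<xi> (r i + k + j)) ((T ^^ k) x j) \<le> \<epsilon>"
                using i(2)[rule_format, of "j + k"] that by (simp add: T_pow add_ac)
            qed
            then show ?thesis
              using U(2)[of i k] T_pow_closure[OF x, of k] by auto
          qed
          then show ?thesis
            using i(1) x by (auto simp: J_def X_def)
        qed
        then show "\<Union> (J ` range c) = topspace X"
          by (auto simp: J_def X_def)
      qed
      also have "\<dots> \<le> card {..<C}"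
        using C(2) by (intro surj_card_le[where f = J]) auto
      finally show ?thesis
        using C(1) by simp
    qed
    with \<open>h > 0\<close> \<open>\<eta> > 0\<close> show ?thesis
      by (intro cover_entropy_le) auto
  qed
  have "cover_entropy X T \<U> \<le> 0" if "open_cover_of X \<U>" for \<U>
    by (rule ereal_le_epsilon2) (simp add: entropy[OF that])
  then have "topological_entropy X T \<le> 0"
    unfolding topological_entropy_def by (intro SUP_least) auto
  moreover have "topological_entropy X T \<ge> 0"
    unfolding topological_entropy_def
    by (rule SUP_upper2[of "{topspace X}"]) (auto simp: open_cover_of_def cover_entropy_nonneg)
  moreover have "compact_space X"
    using compact by (simp add: X_def compact_space_subtopology)
  moreover have "Hausdorff_space X"
    by (simp add: X_def Hausdorff_space_subtopology)
  moreover have "continuous_map X X T"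
    using T_closure continuous_on_subset[OF cont_T]
    by (simp add: X_def image_subset_iff_funcset)
  moreover have "\<xi> \<in> topspace X"
  proof -
    have "\<xi> \<in> Orb"
      unfolding Orb_def by (rule range_eqI[of _ _ 0]) simp
    then show ?thesis
      using closure_subset by (auto simp: X_def)
  qed
  moreover have "continuous_map X euclidean (\<lambda>x. x 0)"
    by (simp add: X_def continuous_on_subset[OF continuous_on_product_coordinates])
  moreover have "\<xi> n = ((T ^^ n) \<xi>) 0" for n
    by (simp add: T_pow)
  ultimately show ?thesis
    unfolding deterministic_def
    by (intro exI[of _ X] exI[of _ T] exI[of _ \<xi>] exI[of _ "\<lambda>x. x 0"]) auto
qed

section \<open>From zero entropy to few windows of an indicator\<close>

lemma openin_iterated_join:
  assumes "open_cover_of X \<U>" "continuous_map X X T" "V \<in> iterated_join X T \<U> n"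
  shows "openin X V"
proof -
  obtain B where V: "V = {x \<in> topspace X. \<forall>i<n. (T ^^ i) x \<in> B i}" and B: "\<And>i. i < n \<Longrightarrow> B i \<in> \<U>"
    using assms(3) unfolding iterated_join_def by blast
  have T_pow: "continuous_map X X (T ^^ i)" for i
  proof (induction i)
    case (Suc i)
    then show ?case
      unfolding funpow.simps by (rule continuous_map_compose) (rule assms(2))
  qed (simp add: id_def)
  have "openin X {x \<in> topspace X. (T ^^ i) x \<in> B i}" if "i < n" for i
    using B[OF that] assms(1) by (intro openin_continuous_map_preimage[OF T_pow]) (auto simp: open_cover_of_def)
  \<comment> \<open>Intersecting with the space handles n = 0, where the indexed intersection is the
    whole type.\<close>
  then have "openin X ((\<Inter>i\<in>{..<n}. {x \<in> topspace X. (T ^^ i) x \<in> B i}) \<inter> topspace X)"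
    by (intro openin_INT finite_lessThan) simp
  also have "(\<Inter>i\<in>{..<n}. {x \<in> topspace X. (T ^^ i) x \<in> B i}) \<inter> topspace X = V"
    unfolding V by auto
  finally show ?thesis .
qed

lemma Union_iterated_join:
  assumes "open_cover_of X \<U>" "continuous_map X X T"
  shows "\<Union>(iterated_join X T \<U> n) = topspace X"
proof (intro equalityI subsetI)
  fix x assume x: "x \<in> topspace X"
  have "(T ^^ i) x \<in> topspace X" for i
    using x continuous_map_image_subset_topspace[OF assms(2)] by (induction i) auto
  then have "(T ^^ i) x \<in> \<Union>\<U>" for i
    using assms(1) by (simp add: open_cover_of_def)
  then have "\<forall>i. \<exists>U. U \<in> \<U> \<and> (T ^^ i) x \<in> U"
    by (meson UnionE)
  then obtain B where "\<forall>i. B i \<in> \<U> \<and> (T ^^ i) x \<in> B i"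
    by (rule choice[THEN exE])
  then show "x \<in> \<Union>(iterated_join X T \<U> n)"
    using x unfolding iterated_join_def by blast
qed (auto simp: iterated_join_def)

text \<open>Compactness makes the set of cardinalities nonempty, and a nonempty set of naturals
  contains its infimum.\<close>

lemma cover_number_attained:
  assumes "compact_space X" "\<And>U. U \<in> \<U> \<Longrightarrow> openin X U" "\<Union>\<U> = topspace X"
  obtains \<V> where "\<V> \<subseteq> \<U>" "finite \<V>" "\<Union>\<V> = topspace X" "card \<V> = cover_number X \<U>"
proof -
  obtain \<V> where \<V>: "finite \<V>" "\<V> \<subseteq> \<U>" "topspace X \<subseteq> \<Union>\<V>"
    using assms unfolding compact_space_alt by (metis order_refl)
  then have "\<Union>\<V> = topspace X"
    using assms(3) by blast
  with \<V> have "card ` {\<V>. \<V> \<subseteq> \<U> \<and> finite \<V> \<and> \<Union>\<V> = topspace X} \<noteq> {}"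
    by blast
  from Inf_nat_def1[OF this] show ?thesis
    using that by (auto simp: cover_number_def)
qed

lemma deterministic_indicator_imp_coverable:
  assumes "deterministic TYPE('a) (indicator S)" "\<eta> > 0"
  shows "\<forall>\<^sub>F h in sequentially. coverable (exp (\<eta> * real h)) UNIV
           (\<lambda>n m. \<forall>j<h. n + j \<in> S \<longleftrightarrow> m + j \<in> S)"
proof -
  obtain X :: "'a topology" and T x\<^sub>0 F where X: "compact_space X" "continuous_map X X T"
    "topological_entropy X T = 0" "x\<^sub>0 \<in> topspace X" "continuous_map X euclidean F"
    and F: "\<And>n. (indicator S n :: complex) = F ((T ^^ n) x\<^sub>0)"
    using assms(1) unfolding deterministic_def by blast
  \<comment> \<open>Two values in a ball of radius 1/2 differ by less than 1, the distance between
    the indicator values 0 and 1. Hence a member of the h-fold join determines a window of length h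
    exactly.\<close>
  define \<U> where "\<U> = range (\<lambda>z :: complex. {x \<in> topspace X. F x \<in> ball z (1 / 2)})"
  have \<U>: "open_cover_of X \<U>"
    unfolding open_cover_of_def
  proof (intro conjI ballI equalityI subsetI)
    show "openin X U" if "U \<in> \<U>" for U
      using that unfolding \<U>_def by (auto intro!: openin_continuous_map_preimage[OF X(5)] simp del: mem_ball)
    fix x assume "x \<in> topspace X"
    then have "x \<in> {y \<in> topspace X. F y \<in> ball (F x) (1 / 2)}"
      by simp
    then show "x \<in> \<Union>\<U>"
      unfolding \<U>_def by blast
  qed (auto simp: \<U>_def)
  define C where "C h = cover_number X (iterated_join X T \<U> h)" for h
  have "cover_entropy X T \<U> \<le> topological_entropy X T"
    unfolding topological_entropy_def using \<U> by (intro SUP_upper) auto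
  then have "limsup (\<lambda>h. ereal (ln (real (C h)) / real h)) < ereal \<eta>"
    using X(3) \<open>\<eta> > 0\<close> unfolding cover_entropy_def C_def
    by (metis ereal_less(2) order_le_less_trans)
  then have "\<forall>\<^sub>F h in sequentially. ereal (ln (real (C h)) / real h) < ereal \<eta>"
    by (rule Limsup_lessD)
  then show ?thesis
    using eventually_gt_at_top[of 0]
  proof eventually_elim
    case (elim h)
    obtain \<V> where \<V>: "\<V> \<subseteq> iterated_join X T \<U> h" "finite \<V>" "\<Union>\<V> = topspace X" "card \<V> = C h"
    proof (rule cover_number_attained[OF X(1)])
      show "openin X V" if "V \<in> iterated_join X T \<U> h" for V
        using openin_iterated_join[OF \<U> X(2) that] .
    qed (auto simp: Union_iterated_join[OF \<U> X(2)] C_def)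
    have orbit: "(T ^^ n) x\<^sub>0 \<in> topspace X" for n
      using X(4) continuous_map_image_subset_topspace[OF X(2)] by (induction n) auto
    have "coverable (real (card \<V>)) UNIV (\<lambda>n m. \<forall>j<h. n + j \<in> S \<longleftrightarrow> m + j \<in> S)"
    proof (rule coverable_finite_cover[where y = "\<lambda>n. (T ^^ n) x\<^sub>0"])
      show "\<exists>V\<in>\<V>. (T ^^ n) x\<^sub>0 \<in> V" for n
        using orbit \<V>(3) by blast
      fix V n m
      assume V: "V \<in> \<V>" "(T ^^ n) x\<^sub>0 \<in> V" "(T ^^ m) x\<^sub>0 \<in> V"
      show "\<forall>j<h. n + j \<in> S \<longleftrightarrow> m + j \<in> S"
      proof (intro allI impI)
        fix j assume "j < h"
        have "\<exists>U\<in>\<U>. \<forall>x\<in>V. (T ^^ j) x \<in> U"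
          using V(1) \<V>(1) \<open>j < h\<close> unfolding iterated_join_def by blast
        then obtain z where "\<And>x. x \<in> V \<Longrightarrow> F ((T ^^ j) x) \<in> ball z (1 / 2)"
          unfolding \<U>_def by blast
        from this[OF V(2)] this[OF V(3)]
        have "indicator S (n + j) \<in> ball z (1 / 2)" "indicator S (m + j) \<in> ball z (1 / 2)"
          unfolding F by (simp_all add: add.commute[of _ j] funpow_add)
        then have "dist (indicator S (n + j) :: complex) (indicator S (m + j)) < 1"
          using dist_triangle_half_r[of z _ 1] by simp
        then show "n + j \<in> S \<longleftrightarrow> m + j \<in> S"
          by (cases "n + j \<in> S"; cases "m + j \<in> S") auto
      qed
    qed (use \<V> in auto)
    moreover have "real (C h) \<le> exp (\<eta> * real h)"
    proof (cases "C h = 0")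
      case False
      have "ln (real (C h)) < \<eta> * real h"
        using elim by (simp add: divide_less_eq)
      then show ?thesis
        using False by (metis exp_le_cancel_iff exp_ln less_imp_le of_nat_0_less_iff neq0_conv)
    qed auto
    ultimately show ?case
      using \<V>(4) by (auto elim: coverable_mono)
  qed
qed


section \<open>Functions with few windows modulo 1 at polynomial precision\<close>

text \<open>The starting point \<open>n0\<close> may depend on \<open>h\<close>: this makes the notion insensitive to perturbations
  that tend to 0 without any rate.\<close>

definition few_windows :: "(nat \<Rightarrow> real) \<Rightarrow> bool" where
  "few_windows f \<longleftrightarrow> (\<forall>D :: nat. \<forall>\<eta>>0. \<forall>\<^sub>F h in sequentially. \<exists>n0.
     coverable (exp (\<eta> * real h)) {n0..}
       (\<lambda>n m. \<forall>j<h. dist_nearest_int (f (n + j) - f (m + j)) * real h ^ D \<le> 1))"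

section \<open>Stability under sums, deterministic indicators and vanishing perturbations\<close>

lemma few_windowsD:
  assumes "few_windows f" "\<eta> > 0"
  shows "\<forall>\<^sub>F h in sequentially. \<exists>n0. coverable (exp (\<eta> * real h)) {n0..}
       (\<lambda>n m. \<forall>j<h. dist_nearest_int (f (n + j) - f (m + j)) * real h ^ D \<le> 1)"
  by (rule assms(1)[unfolded few_windows_def, rule_format, OF assms(2)])

lemma few_windows_const [simp]: "few_windows (\<lambda>_. a)"
  unfolding few_windows_def
proof (intro allI impI always_eventually exI)
  fix D h :: nat and \<eta> :: real
  assume "\<eta> > 0"
  then show "coverable (exp (\<eta> * real h)) {0..}
      (\<lambda>n m. \<forall>j<h. dist_nearest_int (a - a) * real h ^ D \<le> 1)"
    by (intro coverable_trivial) auto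
qed

text \<open>Each summand receives half of the exponent and one more power of h in precision; for h
  at least 2 this power absorbs the factor 2 of the triangle inequality.\<close>

lemma few_windows_add:
  assumes "few_windows f" "few_windows g"
  shows "few_windows (\<lambda>n. f n + g n)"
  unfolding few_windows_def
proof (intro allI impI)
  fix D :: nat and \<eta> :: real
  assume "\<eta> > 0"
  then have "\<eta> / 2 > 0"
    by simp
  show "\<forall>\<^sub>F h in sequentially. \<exists>n0. coverable (exp (\<eta> * real h)) {n0..}
       (\<lambda>n m. \<forall>j<h. dist_nearest_int (f (n + j) + g (n + j) - (f (m + j) + g (m + j))) * real h ^ D \<le> 1)"
    using few_windowsD[OF assms(1) \<open>\<eta> / 2 > 0\<close>, of "Suc D"] few_windowsD[OF assms(2) \<open>\<eta> / 2 > 0\<close>, of "Suc D"]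
      eventually_ge_at_top[of 2]
  proof eventually_elim
    case (elim h)
    obtain n1 n2 where n1: "coverable (exp (\<eta> / 2 * real h)) {n1..}
       (\<lambda>n m. \<forall>j<h. dist_nearest_int (f (n + j) - f (m + j)) * real h ^ Suc D \<le> 1)"
      and n2: "coverable (exp (\<eta> / 2 * real h)) {n2..}
       (\<lambda>n m. \<forall>j<h. dist_nearest_int (g (n + j) - g (m + j)) * real h ^ Suc D \<le> 1)"
      using elim by blast
    have "coverable (exp (\<eta> / 2 * real h)) {max n1 n2..}
       (\<lambda>n m. \<forall>j<h. dist_nearest_int (f (n + j) - f (m + j)) * real h ^ Suc D \<le> 1)"
      "coverable (exp (\<eta> / 2 * real h)) {max n1 n2..}
       (\<lambda>n m. \<forall>j<h. dist_nearest_int (g (n + j) - g (m + j)) * real h ^ Suc D \<le> 1)"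
      by (rule coverable_mono[OF n1] coverable_mono[OF n2]; simp)+
    from coverable_conj[OF this]
    have "coverable (exp (\<eta> * real h)) {max n1 n2..}
       (\<lambda>n m. \<forall>j<h. dist_nearest_int (f (n + j) + g (n + j) - (f (m + j) + g (m + j))) * real h ^ D \<le> 1)"
    proof (rule coverable_mono)
      show "exp (\<eta> / 2 * real h) * exp (\<eta> / 2 * real h) \<le> exp (\<eta> * real h)"
        by (simp flip: exp_add)
      fix n m
      assume *: "(\<forall>j<h. dist_nearest_int (f (n + j) - f (m + j)) * real h ^ Suc D \<le> 1) \<and>
        (\<forall>j<h. dist_nearest_int (g (n + j) - g (m + j)) * real h ^ Suc D \<le> 1)"
      show "\<forall>j<h. dist_nearest_int (f (n + j) + g (n + j) - (f (m + j) + g (m + j))) * real h ^ D \<le> 1"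
      proof (intro allI impI)
        fix j assume "j < h"
        define a where "a = f (n + j) - f (m + j)"
        define b where "b = g (n + j) - g (m + j)"
        define H where "H = real h ^ D"
        have ab: "(dist_nearest_int a * H) * real h \<le> 1" "(dist_nearest_int b * H) * real h \<le> 1"
          using * \<open>j < h\<close> by (auto simp: a_def b_def H_def mult_ac)
        have "dist_nearest_int (a + b) * H \<le> dist_nearest_int a * H + dist_nearest_int b * H"
          using mult_right_mono[OF dist_nearest_int_add_le[of a b], of H] by (simp add: H_def distrib_right)
        moreover have "dist_nearest_int a * H * 2 \<le> dist_nearest_int a * H * real h"
          "dist_nearest_int b * H * 2 \<le> dist_nearest_int b * H * real h"
          using elim by (intro mult_left_mono; simp add: H_def)+
        ultimately have "dist_nearest_int (a + b) * H \<le> 1"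
          using ab by linarith
        then show "dist_nearest_int (f (n + j) + g (n + j) - (f (m + j) + g (m + j))) * real h ^ D \<le> 1"
          by (simp add: a_def b_def H_def algebra_simps)
      qed
    qed auto
    then show ?case
      by blast
  qed
qed

lemma few_windows_sum:
  assumes "\<And>i. i \<in> I \<Longrightarrow> few_windows (f i)"
  shows "few_windows (\<lambda>n. \<Sum>i\<in>I. f i n)"
  using assms by (induction I rule: infinite_finite_induct) (auto intro: few_windows_add)

text \<open>Where the windows of \<open>S\<close> agree exactly, each difference of products is
  either 0 or the difference of the values of \<open>f\<close>, so no precision is lost.\<close>

lemma few_windows_indicator_mult:
  assumes "few_windows f" "deterministic TYPE('a) (indicator S)"
  shows "few_windows (\<lambda>n. indicator S n * f n)"
  unfolding few_windows_def
proof (intro allI impI)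
  fix D :: nat and \<eta> :: real
  assume "\<eta> > 0"
  then have "\<eta> / 2 > 0"
    by simp
  show "\<forall>\<^sub>F h in sequentially. \<exists>n0. coverable (exp (\<eta> * real h)) {n0..}
       (\<lambda>n m. \<forall>j<h. dist_nearest_int (indicator S (n + j) * f (n + j) - indicator S (m + j) * f (m + j))
          * real h ^ D \<le> 1)"
    using few_windowsD[OF assms(1) \<open>\<eta> / 2 > 0\<close>, of D]
      deterministic_indicator_imp_coverable[OF assms(2) \<open>\<eta> / 2 > 0\<close>]
  proof eventually_elim
    case (elim h)
    obtain n0 where n0: "coverable (exp (\<eta> / 2 * real h)) {n0..}
       (\<lambda>n m. \<forall>j<h. dist_nearest_int (f (n + j) - f (m + j)) * real h ^ D \<le> 1)"
      using elim by blast
    have "coverable (exp (\<eta> / 2 * real h)) {n0..} (\<lambda>n m. \<forall>j<h. n + j \<in> S \<longleftrightarrow> m + j \<in> S)"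
      by (rule coverable_mono[OF elim(2)]) auto
    from coverable_conj[OF n0 this]
    have "coverable (exp (\<eta> * real h)) {n0..}
       (\<lambda>n m. \<forall>j<h. dist_nearest_int (indicator S (n + j) * f (n + j) - indicator S (m + j) * f (m + j))
          * real h ^ D \<le> 1)"
      by (rule coverable_mono) (auto simp: indicator_def simp flip: exp_add)
    then show ?case
      by blast
  qed
qed

lemma few_windows_perturb:
  assumes "few_windows g" "(\<lambda>n. dist_nearest_int (f n - g n)) \<longlonglongrightarrow> 0"
  shows "few_windows f"
  unfolding few_windows_def
proof (intro allI impI)
  fix D :: nat and \<eta> :: real
  assume "\<eta> > 0"
  show "\<forall>\<^sub>F h in sequentially. \<exists>n0. coverable (exp (\<eta> * real h)) {n0..}
       (\<lambda>n m. \<forall>j<h. dist_nearest_int (f (n + j) - f (m + j)) * real h ^ D \<le> 1)"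
    using few_windowsD[OF assms(1) \<open>\<eta> > 0\<close>, of "Suc D"] eventually_ge_at_top[of 3]
  proof eventually_elim
    case (elim h)
    define H where "H = real h ^ D"
    have "H > 0"
      using elim by (simp add: H_def)
    obtain n1 where n1: "coverable (exp (\<eta> * real h)) {n1..}
       (\<lambda>n m. \<forall>j<h. dist_nearest_int (g (n + j) - g (m + j)) * real h ^ Suc D \<le> 1)"
      using elim by blast
    \<comment> \<open>Here h is already fixed, so mere convergence to 0 suffices. The allowed error
      is split into thirds: one for each of the two perturbations and one for \<open>g\<close>,
      where the additional power of h is at least 3.\<close>
    have "\<forall>\<^sub>F n in sequentially. dist_nearest_int (f n - g n) < 1 / (3 * H)"
      using \<open>H > 0\<close> by (intro order_tendstoD(2)[OF assms(2)]) auto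
    then obtain n2 where n2: "\<And>n. n \<ge> n2 \<Longrightarrow> dist_nearest_int (f n - g n) < 1 / (3 * H)"
      unfolding eventually_sequentially by blast
    have "coverable (exp (\<eta> * real h)) {max n1 n2..}
       (\<lambda>n m. \<forall>j<h. dist_nearest_int (f (n + j) - f (m + j)) * real h ^ D \<le> 1)"
    proof (rule coverable_mono[OF n1])
      fix n m
      assume nm: "n \<in> {max n1 n2..}" "m \<in> {max n1 n2..}"
      assume *: "\<forall>j<h. dist_nearest_int (g (n + j) - g (m + j)) * real h ^ Suc D \<le> 1"
      show "\<forall>j<h. dist_nearest_int (f (n + j) - f (m + j)) * real h ^ D \<le> 1"
      proof (intro allI impI)
        fix j assume "j < h"
        define a where "a = f (n + j) - g (n + j)"
        define b where "b = f (m + j) - g (m + j)"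
        define c where "c = g (n + j) - g (m + j)"
        have "dist_nearest_int a * H \<le> 1 / 3" "dist_nearest_int b * H \<le> 1 / 3"
          using n2[of "n + j"] n2[of "m + j"] nm \<open>H > 0\<close> by (simp_all add: a_def b_def field_simps)
        moreover have "dist_nearest_int c * H \<le> 1 / 3"
        proof -
          have "dist_nearest_int c * H * 3 \<le> dist_nearest_int c * H * real h"
            using elim \<open>H > 0\<close> by (intro mult_left_mono) auto
          also have "\<dots> \<le> 1"
            using * \<open>j < h\<close> by (auto simp: c_def H_def mult_ac)
          finally show ?thesis
            by simp
        qed
        moreover have "dist_nearest_int (f (n + j) - f (m + j))
            \<le> dist_nearest_int a + dist_nearest_int b + dist_nearest_int c"
          using dist_nearest_int_add_le[of "a + c" "- b"] dist_nearest_int_add_le[of a c]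
          by (simp add: a_def b_def c_def dist_nearest_int_minus[of "f (m + j) - g (m + j)", simplified])
        from mult_right_mono[OF this, of H] \<open>H > 0\<close>
        have "dist_nearest_int (f (n + j) - f (m + j)) * H
            \<le> dist_nearest_int a * H + dist_nearest_int b * H + dist_nearest_int c * H"
          by (simp add: distrib_right)
        ultimately have "dist_nearest_int (f (n + j) - f (m + j)) * H \<le> 1"
          by linarith
        then show "dist_nearest_int (f (n + j) - f (m + j)) * real h ^ D \<le> 1"
          by (simp add: H_def)
      qed
    qed auto
    then show ?case
      by blast
  qed
qed

section \<open>Antidifferences and polynomials\<close>

lemma sum_difference_op: "f (n + j) = f n + (\<Sum>i<j. difference_op f (n + i))"
  by (induction j) (auto simp: difference_op_def)

text \<open>Differences are taken at precision h^-(D+2) and the first value at h^-(D+1). Summing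
  fewer than h differences gives a total error of at most 2 h^-(D+1), hence at most h^-D for h at
  least 2. The first value costs a factor h^(D+1), eventually below exp(\<eta> h / 2).\<close>

lemma few_windows_antidifference:
  assumes "few_windows (difference_op f)"
  shows "few_windows f"
  unfolding few_windows_def
proof (intro allI impI)
  fix D :: nat and \<eta> :: real
  assume "\<eta> > 0"
  then have "\<eta> / 2 > 0"
    by simp
  have "((\<lambda>x :: real. x ^ Suc D / exp (\<eta> / 2 * x)) \<longlongrightarrow> 0) at_top"
    using \<open>\<eta> / 2 > 0\<close> by real_asymp
  then have "((\<lambda>h. real h ^ Suc D / exp (\<eta> / 2 * real h)) \<longlongrightarrow> 0) sequentially"
    using filterlim_compose filterlim_real_sequentially by blast
  then have "\<forall>\<^sub>F h in sequentially. real h ^ Suc D / exp (\<eta> / 2 * real h) < 1"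
    by (intro order_tendstoD(2)) auto
  then show "\<forall>\<^sub>F h in sequentially. \<exists>n0. coverable (exp (\<eta> * real h)) {n0..}
       (\<lambda>n m. \<forall>j<h. dist_nearest_int (f (n + j) - f (m + j)) * real h ^ D \<le> 1)"
    using few_windowsD[OF assms \<open>\<eta> / 2 > 0\<close>, of "Suc (Suc D)"] eventually_ge_at_top[of 2]
  proof eventually_elim
    case (elim h)
    define H where "H = real h ^ D"
    have "H > 0"
      using elim by (simp add: H_def)
    obtain n0 where n0: "coverable (exp (\<eta> / 2 * real h)) {n0..}
       (\<lambda>n m. \<forall>j<h. dist_nearest_int (difference_op f (n + j) - difference_op f (m + j)) * real h ^ Suc (Suc D) \<le> 1)"
      using elim by blast
    have "coverable (real (h ^ Suc D)) {n0..} (\<lambda>n m. dist_nearest_int (f n - f m) * real (h ^ Suc D) \<le> 1)"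
      using elim by (intro coverable_mono[OF coverable_mod_1[of "h ^ Suc D" f]]) auto
    from coverable_conj[OF n0 this]
    have "coverable (exp (\<eta> * real h)) {n0..}
       (\<lambda>n m. \<forall>j<h. dist_nearest_int (f (n + j) - f (m + j)) * real h ^ D \<le> 1)"
    proof (rule coverable_mono)
      have "real (h ^ Suc D) \<le> exp (\<eta> / 2 * real h)"
        using elim by (simp add: divide_less_eq)
      then have "exp (\<eta> / 2 * real h) * real (h ^ Suc D) \<le> exp (\<eta> / 2 * real h) * exp (\<eta> / 2 * real h)"
        by (intro mult_left_mono) auto
      also have "\<dots> = exp (\<eta> * real h)"
        by (simp flip: exp_add)
      finally show "exp (\<eta> / 2 * real h) * real (h ^ Suc D) \<le> exp (\<eta> * real h)" .
      fix n m
      assume *: "(\<forall>j<h. dist_nearest_int (difference_op f (n + j) - difference_op f (m + j)) * real h ^ Suc (Suc D) \<le> 1)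
          \<and> dist_nearest_int (f n - f m) * real (h ^ Suc D) \<le> 1"
      show "\<forall>j<h. dist_nearest_int (f (n + j) - f (m + j)) * real h ^ D \<le> 1"
      proof (intro allI impI)
        fix j assume "j < h"
        define d where "d i = difference_op f (n + i) - difference_op f (m + i)" for i
        have d: "dist_nearest_int (d i) * (real h * real h * H) \<le> 1" if "i < j" for i
          using * that \<open>j < h\<close> by (auto simp: d_def H_def mult_ac)
        have "f (n + j) - f (m + j) = (f n - f m) + (\<Sum>i<j. d i)"
          by (simp add: sum_difference_op[of f n] sum_difference_op[of f m] d_def sum_subtractf)
        then have "dist_nearest_int (f (n + j) - f (m + j))
            \<le> dist_nearest_int (f n - f m) + (\<Sum>i<j. dist_nearest_int (d i))"
          using dist_nearest_int_add_le[of "f n - f m" "\<Sum>i<j. d i"] dist_nearest_int_sum_le[of d "{..<j}"]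
          by simp
        \<comment> \<open>After scaling by h^(D+2), each difference contributes at most 1 and the
          first value at most h.\<close>
        from mult_right_mono[OF this, of "real h * real h * H"] \<open>H > 0\<close>
        have "dist_nearest_int (f (n + j) - f (m + j)) * (real h * real h * H)
            \<le> dist_nearest_int (f n - f m) * (real h * real h * H)
              + (\<Sum>i<j. dist_nearest_int (d i) * (real h * real h * H))"
          by (simp add: distrib_right sum_distrib_right)
        also have "(\<Sum>i<j. dist_nearest_int (d i) * (real h * real h * H)) \<le> (\<Sum>i<j. 1)"
          using d by (intro sum_mono) auto
        also have "(\<Sum>i<j. 1) \<le> real h"
          using \<open>j < h\<close> by simp
        also have "dist_nearest_int (f n - f m) * (real h * real h * H)
            = (dist_nearest_int (f n - f m) * real (h ^ Suc D)) * real h"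
          by (simp add: H_def)
        also have "\<dots> \<le> 1 * real h"
          using * by (intro mult_right_mono) auto
        finally have "(dist_nearest_int (f (n + j) - f (m + j)) * H * real h) * real h \<le> 2 * real h"
          by (simp add: mult_ac)
        then have "dist_nearest_int (f (n + j) - f (m + j)) * H * real h \<le> 2"
          using elim by (subst (asm) mult_le_cancel_right) auto
        moreover have "dist_nearest_int (f (n + j) - f (m + j)) * H * 2
            \<le> dist_nearest_int (f (n + j) - f (m + j)) * H * real h"
          using elim \<open>H > 0\<close> by (intro mult_left_mono) auto
        ultimately have "dist_nearest_int (f (n + j) - f (m + j)) * H \<le> 1"
          by linarith
        then show "dist_nearest_int (f (n + j) - f (m + j)) * real h ^ D \<le> 1"
          by (simp add: H_def)
      qed
    qed auto
    then show ?case
      by blast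
  qed
qed

lemma few_windows_funpow_antidifference:
  assumes "few_windows ((difference_op ^^ k) f)"
  shows "few_windows f"
  using assms
proof (induction k arbitrary: f)
  case (Suc k)
  then have "few_windows ((difference_op ^^ k) (difference_op f))"
    by (simp add: funpow_Suc_right del: funpow.simps)
  then have "few_windows (difference_op f)"
    by (rule Suc.IH)
  then show ?case
    by (rule few_windows_antidifference)
qed simp

text \<open>The difference is a combination of lower powers, and it vanishes for d = 0. The
  coefficient stays in the statement and varies in the induction, since multiplication by a real
  number is not compatible with reduction modulo 1.\<close>

lemma few_windows_monom: "few_windows (\<lambda>n. a * real n ^ d)"
proof (induction d arbitrary: a rule: less_induct)
  case (less d)
  have "difference_op (\<lambda>n. a * real n ^ d) = (\<lambda>n. \<Sum>i<d. a * real (d choose i) * real n ^ i)"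
  proof
    fix n
    have "(real n + 1) ^ d = (\<Sum>i\<le>d. real (d choose i) * real n ^ i)"
      by (simp add: binomial_ring)
    also have "\<dots> = (\<Sum>i<d. real (d choose i) * real n ^ i) + real n ^ d"
      by (simp add: lessThan_Suc_atMost[symmetric])
    finally have "(1 + real n) ^ d = (\<Sum>i<d. real (d choose i) * real n ^ i) + real n ^ d"
      by (simp only: add.commute)
    then show "difference_op (\<lambda>n. a * real n ^ d) n = (\<Sum>i<d. a * real (d choose i) * real n ^ i)"
      by (simp add: difference_op_def distrib_left sum_distrib_left mult.assoc)
  qed
  moreover have "few_windows (\<lambda>n. \<Sum>i<d. a * real (d choose i) * real n ^ i)"
    by (intro few_windows_sum less.IH) auto
  ultimately have "few_windows (difference_op (\<lambda>n. a * real n ^ d))"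
    by (simp only:)
  then show ?case
    by (rule few_windows_antidifference)
qed

lemma few_windows_poly: "few_windows (\<lambda>n. poly q (real n))"
proof -
  have "few_windows (\<lambda>n. \<Sum>i\<le>degree q. coeff q i * real n ^ i)"
    by (rule few_windows_sum, rule few_windows_monom)
  then show ?thesis
    by (simp only: poly_altdef)
qed

section \<open>Return to deterministic functions and conclusion\<close>

lemma few_windows_imp_deterministic:
  assumes "few_windows f"
  shows "deterministic TYPE(nat \<Rightarrow> complex) (\<lambda>n. unit_exp (f n))"
proof (rule deterministicI)
  show "bounded (range (\<lambda>n. unit_exp (f n)))"
    by (auto simp: bounded_iff unit_exp_eq_cis)
next
  fix \<epsilon> \<eta> :: real
  assume "\<epsilon> > 0" "\<eta> > 0"
  \<comment> \<open>Precision 1/h modulo 1, the case D = 1, becomes 2 pi / h on the unit circle by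
    \<open>dist_unit_exp_le\<close>. A single h of this size is enough for
    \<open>deterministicI\<close>.\<close>
  have "\<forall>\<^sub>F h in sequentially. 2 * pi / \<epsilon> \<le> real h"
    by (rule eventually_compose_filterlim[OF eventually_ge_at_top filterlim_real_sequentially])
  from eventually_conj[OF few_windowsD[OF assms \<open>\<eta> > 0\<close>, of 1]
      eventually_conj[OF this eventually_gt_at_top[of 0]]]
  obtain h n0 where "h > 0" and h: "2 * pi / \<epsilon> \<le> real h"
    and n0: "coverable (exp (\<eta> * real h)) {n0..}
       (\<lambda>n m. \<forall>j<h. dist_nearest_int (f (n + j) - f (m + j)) * real h ^ 1 \<le> 1)"
    by (auto dest!: eventually_happens'[OF sequentially_bot])
  have "coverable (exp (\<eta> * real h)) {n0..}
      (\<lambda>n m. \<forall>j<h. dist (unit_exp (f (n + j))) (unit_exp (f (m + j))) \<le> \<epsilon>)"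
  proof (rule coverable_mono[OF n0])
    fix n m
    assume *: "\<forall>j<h. dist_nearest_int (f (n + j) - f (m + j)) * real h ^ 1 \<le> 1"
    show "\<forall>j<h. dist (unit_exp (f (n + j))) (unit_exp (f (m + j))) \<le> \<epsilon>"
    proof (intro allI impI)
      fix j assume "j < h"
      define d where "d = dist_nearest_int (f (n + j) - f (m + j))"
      have "2 * pi * d \<le> real h * \<epsilon> * d"
        using h \<open>\<epsilon> > 0\<close> by (intro mult_right_mono) (auto simp: d_def field_simps)
      also have "\<dots> = \<epsilon> * (d * real h)"
        by simp
      also have "\<dots> \<le> \<epsilon> * 1"
        using * \<open>j < h\<close> \<open>\<epsilon> > 0\<close> by (intro mult_left_mono) (auto simp: d_def)
      finally show "dist (unit_exp (f (n + j))) (unit_exp (f (m + j))) \<le> \<epsilon>"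
        using dist_unit_exp_le[of "f (n + j)" "f (m + j)"] by (simp add: d_def)
    qed
  qed auto
  with \<open>h > 0\<close> show "\<exists>h>0. \<exists>n0. coverable (exp (\<eta> * real h)) {n0..}
      (\<lambda>n m. \<forall>j<h. dist (unit_exp (f (n + j))) (unit_exp (f (m + j))) \<le> \<epsilon>)"
    by (intro exI conjI)
qed

lemma difference_op_summation_op: "difference_op (summation_op f) = f"
  by (rule ext) (simp add: difference_op_def summation_op_def)

theorem theorem1p2:
  fixes w k :: nat
    and p :: "nat \<Rightarrow> real poly"
    and S :: "nat \<Rightarrow> nat set"
    and f g :: "nat \<Rightarrow> real"
  assumes "w \<ge> 1"
    and "(\<Union>v\<in>{1..w}. S v) = UNIV"
    and "disjoint_family_on S {1..w}"
    and "\<And>v. v \<in> {1..w} \<Longrightarrow> deterministic TYPE('a) (indicator (S v))"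
    and "\<And>n. g n = (\<Sum>v = 1..w. indicator (S v) n * poly (p v) (real n))"
    and "(\<lambda>n. dist_nearest_int ((difference_op ^^ k) f n - g n)) \<longlonglongrightarrow> 0"
  shows "deterministic TYPE(nat \<Rightarrow> complex) (\<lambda>n. unit_exp (f n)) \<and>
         deterministic TYPE(nat \<Rightarrow> complex) (\<lambda>n. unit_exp (summation_op f n))"
proof -
  have "few_windows (\<lambda>n. \<Sum>v = 1..w. indicator (S v) n * poly (p v) (real n))"
    by (rule few_windows_sum, rule few_windows_indicator_mult[OF few_windows_poly], rule assms(4))
  then have "few_windows g"
    unfolding assms(5)[abs_def] .
  then have "few_windows ((difference_op ^^ k) f)"
    using assms(6) by (rule few_windows_perturb)
  then have f: "few_windows f"
    by (rule few_windows_funpow_antidifference)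
  then have "few_windows (difference_op (summation_op f))"
    by (simp only: difference_op_summation_op)
  then have "few_windows (summation_op f)"
    by (rule few_windows_antidifference)
  with f show ?thesis
    by (intro conjI few_windows_imp_deterministic)
qed

end
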